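(* Let $f : \mathbb{Z}^{n} \to \mathbb{R} \cup \{+\infty\}$ be an integrally convex function and let $\varphi : \mathbb{Z}^{n} \to \mathbb{R} \cup \{+\infty\}$ be a separable convex function. Let $f \,\Box\, \varphi$ be their (integer infimal) convolution, $$ (f \,\Box\, \varphi)(x) = \inf\{ f(y) + \varphi(z) \mid x = y + z, \ y, z \in \mathbb{Z}^{n} \} \qquad (x \in \mathbb{Z}^{n}), $$ and assume that the infimum on the right-hand side is not equal to $-\infty$ for every $x \in \mathbb{Z}^{n}$. Then $f \,\Box\, \varphi : \mathbb{Z}^{n} \to \mathbb{R} \cup \{+\infty\}$ is an integrally convex function.
   Context: For $x \in \mathbb{R}^{n}$, the integral neighborhood of $x$ is $N(x) = \{ z \in \mathbb{Z}^{n} \mid |x_i - z_i| < 1 \ (i=1,\ldots,n) \}$. For $f : \mathbb{Z}^{n} \to \mathbb{R} \cup \{+\infty\}$, the local convex extension $\tilde f : \mathbb{R}^{n} \to \mathbb{R} \cup \{+\infty\}$ is defined by $\tilde f(x) = \min\{ \sum_{y \in N(x)} \lambda_y f(y) \mid \sum_{y \in N(x)} \lambda_y y = x, \ \sum_{y \in N(x)} \lambda_y = 1, \ \lambda_y \ge 0 \ (\forall y \in N(x)) \}$ (with the convention $0 \cdot (+\infty) = 0$). The function $f$ is integrally convex if $\tilde f$ is a convex function on $\mathbb{R}^{n}$. A function $\varphi : \mathbb{Z}^{n} \to \mathbb{R} \cup \{+\infty\}$ is separable convex if $\varphi(x) = \varphi_1(x_1) + \cdots + \varphi_n(x_n)$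 for univariate discrete convex functions $\varphi_i : \mathbb{Z} \to \mathbb{R} \cup \{+\infty\}$, i.e., functions such that $\varphi_i(t-1) + \varphi_i(t+1) \ge 2\varphi_i(t)$ for all $t \in \mathbb{Z}$ and such that $\{ t \in \mathbb{Z} \mid \varphi_i(t) < +\infty \}$ is an interval of consecutive integers (possibly unbounded). *)

theory Defs
  imports "HOL-Analysis.Analysis"
begin

text \<open>Functions with values in \<open>\<real> \<union> {+\<infinity>}\<close> are \<^typ>\<open>ereal\<close>-valued functions that avoid
  \<open>-\<infinity>\<close>.  The convention \<open>0 \<cdot> (+\<infinity>) = 0\<close> is that of \<^typ>\<open>ereal\<close> multiplication.\<close>

definition never_minus_infinity :: "('a \<Rightarrow> ereal) \<Rightarrow> bool" where
  "never_minus_infinity f \<longleftrightarrow> (\<forall>x. f x \<noteq> -\<infinity>)"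

definition real_vec :: "int ^ 'n \<Rightarrow> real ^ 'n" where
  "real_vec z = (\<chi> i. real_of_int (z $ i))"

definition integral_nbhd :: "real ^ 'n \<Rightarrow> (int ^ 'n) set" where
  "integral_nbhd x = {z. \<forall>i. \<bar>x $ i - real_of_int (z $ i)\<bar> < 1}"

text \<open>The neighborhood is finite and has \<open>x\<close> in its convex hull, so for \<open>f\<close> avoiding \<open>-\<infinity>\<close>
  the infimum below is a minimum, and it is not \<open>-\<infinity>\<close>.  The values of \<open>c\<close> outside the
  neighborhood play no role.\<close>

definition local_convex_ext :: "(int ^ 'n \<Rightarrow> ereal) \<Rightarrow> real ^ 'n \<Rightarrow> ereal" where
  "local_convex_ext f x =
     Inf {(\<Sum>y\<in>integral_nbhd x. ereal (c y) * f y) | c :: int ^ 'n \<Rightarrow> real.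
            (\<Sum>y\<in>integral_nbhd x. c y *\<^sub>R real_vec y) = x \<and>
            (\<Sum>y\<in>integral_nbhd x. c y) = 1 \<and>
            (\<forall>y\<in>integral_nbhd x. 0 \<le> c y)}"

text \<open>The library's \<^const>\<open>convex_on\<close> is for real-valued functions only.\<close>

definition ereal_convex :: "('a::real_vector \<Rightarrow> ereal) \<Rightarrow> bool" where
  "ereal_convex g \<longleftrightarrow>
     (\<forall>x y. \<forall>t\<in>{0..1}.
        g ((1 - t) *\<^sub>R x + t *\<^sub>R y) \<le> ereal (1 - t) * g x + ereal t * g y)"

definition integrally_convex :: "(int ^ 'n \<Rightarrow> ereal) \<Rightarrow> bool" where
  "integrally_convex f \<longleftrightarrow> never_minus_infinity f \<and> ereal_convex (local_convex_ext f)"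

text \<open>The last conjunct says that the effective domain is an interval of consecutive integers
  (possibly unbounded, possibly empty).\<close>

definition discrete_convex :: "(int \<Rightarrow> ereal) \<Rightarrow> bool" where
  "discrete_convex \<psi> \<longleftrightarrow>
     never_minus_infinity \<psi> \<and>
     (\<forall>t. \<psi> (t - 1) + \<psi> (t + 1) \<ge> 2 * \<psi> t) \<and>
     (\<forall>a b t. \<psi> a < \<infinity> \<longrightarrow> \<psi> b < \<infinity> \<longrightarrow> a \<le> t \<longrightarrow> t \<le> b \<longrightarrow> \<psi> t < \<infinity>)"

definition separable_convex :: "(int ^ 'n \<Rightarrow> ereal) \<Rightarrow> bool" where
  "separable_convex \<phi> \<longleftrightarrow>
     (\<exists>\<psi> :: 'n \<Rightarrow> int \<Rightarrow> ereal.
        (\<forall>i. discrete_convex (\<psi> i)) \<and> (\<forall>x. \<phi> x = (\<Sum>i\<in>UNIV. \<psi> i (x $ i))))"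

definition convolution :: "(int ^ 'n \<Rightarrow> ereal) \<Rightarrow> (int ^ 'n \<Rightarrow> ereal) \<Rightarrow> int ^ 'n \<Rightarrow> ereal" where
  "convolution f g x = Inf {f y + g z | y z. x = y + z}"

end

theory Submission
  imports Defs
begin

text \<open>A function avoiding \<open>-\<infinity>\<close> is integrally convex iff its local convex extension lies below the
  convex envelope of its values at integer points.  A point over the convex hull of the epigraph of
  \<open>f \<box> \<phi>\<close> splits, up to an arbitrarily small error, as \<open>y + z\<close> with \<open>y\<close> over the hull for \<open>f\<close> and
  \<open>z\<close> over the hull for \<open>\<phi>\<close>.  Integral convexity of \<open>f\<close> realises the value at \<open>y\<close> by a random
  integer point \<open>u\<close> of \<open>N(y)\<close> with mean \<open>y\<close>, and convexity of each \<open>\<phi>\<^sub>i\<close> lets \<open>z\<^sub>i\<close> be realised by a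
  random rounding \<open>w\<^sub>i\<close> to one of the two neighbouring integers.  Only the marginals of \<open>u\<close> and of the
  \<open>w\<^sub>i\<close> enter the expected value of \<open>f(u) + \<phi>(w)\<close>, so \<open>w\<^sub>i\<close> may be coupled to \<open>u\<^sub>i\<close>: if the fractional
  parts of \<open>y\<^sub>i\<close> and \<open>z\<^sub>i\<close> sum to at most 1, the two are never rounded up together, and otherwise
  they are never rounded down together.  Then \<open>u + w\<close> lies in \<open>N(y + z)\<close> and has mean \<open>y + z\<close>.\<close>

section \<open>Local convex extensions and convex hulls of epigraphs\<close>

text \<open>The infimum of the heights over a point is the convex envelope of \<open>f\<close>
  there. Heights are real, so points with value \<open>\<infinity>\<close> contribute nothing and
  convex combinations stay within real arithmetic.\<close>

definition epi_hull :: "(int ^ 'n \<Rightarrow> ereal) \<Rightarrow> ((real ^ 'n) \<times> real) set" where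
  "epi_hull f = convex hull {(real_vec v, h) | v h. f v \<le> ereal h}"

lemma finite_integral_nbhd: "finite (integral_nbhd x)"
proof -
  have "integral_nbhd x \<subseteq> vec_lambda ` (PiE UNIV (\<lambda>i. {\<lfloor>x $ i\<rfloor> - 1..\<lfloor>x $ i\<rfloor> + 1}))"
  proof
    fix z assume z: "z \<in> integral_nbhd x"
    have "(\<lambda>i. z $ i) \<in> PiE UNIV (\<lambda>i. {\<lfloor>x $ i\<rfloor> - 1..\<lfloor>x $ i\<rfloor> + 1})"
    proof (rule PiE_I)
      fix i
      have "\<bar>x $ i - real_of_int (z $ i)\<bar> < 1" using z by (auto simp: integral_nbhd_def)
      then show "z $ i \<in> {\<lfloor>x $ i\<rfloor> - 1..\<lfloor>x $ i\<rfloor> + 1}" by simp linarith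
    qed simp
    then have "vec_lambda (\<lambda>i. z $ i) \<in> vec_lambda ` (PiE UNIV (\<lambda>i. {\<lfloor>x $ i\<rfloor> - 1..\<lfloor>x $ i\<rfloor> + 1}))"
      by (rule imageI)
    then show "z \<in> vec_lambda ` (PiE UNIV (\<lambda>i. {\<lfloor>x $ i\<rfloor> - 1..\<lfloor>x $ i\<rfloor> + 1}))" by simp
  qed
  moreover have "finite (vec_lambda ` (PiE (UNIV::'a set) (\<lambda>i. {\<lfloor>x $ i\<rfloor> - 1..\<lfloor>x $ i\<rfloor> + 1})))"
    by (intro finite_imageI finite_PiE) auto
  ultimately show ?thesis by (rule finite_subset)
qed

lemma real_vec_add: "real_vec (u + w) = real_vec u + real_vec w"
  by (simp add: real_vec_def vec_eq_iff)

text \<open>Adding the weights of all indices that share a point gives an admissible competitor in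
  the infimum. The index set is arbitrary because different pairs of roundings may have the same sum
  \<open>u + w\<close>.\<close>

lemma local_convex_ext_le_sum:
  fixes v :: "'k \<Rightarrow> int ^ 'n"
  assumes K: "finite K" and nonneg: "\<And>k. k \<in> K \<Longrightarrow> 0 \<le> \<mu> k" and one: "(\<Sum>k\<in>K. \<mu> k) = 1"
    and bary: "(\<Sum>k\<in>K. \<mu> k *\<^sub>R real_vec (v k)) = x"
    and supp: "\<And>k. k \<in> K \<Longrightarrow> 0 < \<mu> k \<Longrightarrow> v k \<in> integral_nbhd x \<and> f (v k) \<le> ereal (h k)"
  shows "local_convex_ext f x \<le> ereal (\<Sum>k\<in>K. \<mu> k * h k)"
proof -
  define P where "P = {k \<in> K. 0 < \<mu> k}"
  \<comment> \<open>\<open>c\<close> is the image of the weights under \<open>v\<close>. Only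
    indices in \<open>P\<close> are collected, since \<open>v\<close> may leave the neighborhood at
    the others.\<close>
  define c where "c y = (\<Sum>k\<in>{k \<in> P. v k = y}. \<mu> k)" for y
  have P: "finite P" "v ` P \<subseteq> integral_nbhd x" using K supp by (auto simp: P_def)
  have restrict: "(\<Sum>k\<in>P. g k) = (\<Sum>k\<in>K. g k)"
    if "\<And>k. \<mu> k = 0 \<Longrightarrow> g k = 0" for g :: "'k \<Rightarrow> 'c::comm_monoid_add"
    by (rule sum.mono_neutral_left) (use K nonneg that in \<open>auto simp: P_def order.order_iff_strict\<close>)
  have fibre: "(\<Sum>y\<in>integral_nbhd x. \<Sum>k\<in>{k \<in> P. v k = y}. g k) = (\<Sum>k\<in>P. g k)"
    for g :: "'k \<Rightarrow> 'c::comm_monoid_add"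
    using P finite_integral_nbhd by (intro sum.group) auto
  have "(\<Sum>y\<in>integral_nbhd x. c y) = 1"
    unfolding c_def fibre using restrict[of \<mu>] one by simp
  moreover have "(\<Sum>y\<in>integral_nbhd x. c y *\<^sub>R real_vec y) = x"
  proof -
    have "(\<Sum>y\<in>integral_nbhd x. c y *\<^sub>R real_vec y)
        = (\<Sum>y\<in>integral_nbhd x. \<Sum>k\<in>{k \<in> P. v k = y}. \<mu> k *\<^sub>R real_vec (v k))"
      unfolding c_def scaleR_sum_left by (intro sum.cong refl) auto
    then show ?thesis unfolding fibre using restrict[of "\<lambda>k. \<mu> k *\<^sub>R real_vec (v k)"] bary by simp
  qed
  moreover have "\<forall>y\<in>integral_nbhd x. 0 \<le> c y"
    by (auto simp: c_def P_def intro!: sum_nonneg)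
  ultimately have "local_convex_ext f x \<le> (\<Sum>y\<in>integral_nbhd x. ereal (c y) * f y)"
    unfolding local_convex_ext_def by (intro Inf_lower) blast
  also have "\<dots> \<le> (\<Sum>y\<in>integral_nbhd x. ereal (\<Sum>k\<in>{k \<in> P. v k = y}. \<mu> k * h k))"
  proof (rule sum_mono)
    fix y
    show "ereal (c y) * f y \<le> ereal (\<Sum>k\<in>{k \<in> P. v k = y}. \<mu> k * h k)"
    proof (cases "{k \<in> P. v k = y} = {}")
      \<comment> \<open>\<open>f y\<close> may be infinite here; the convention 0 * \<infinity> = 0
        makes the term vanish.\<close>
      case True
      then have "c y = 0" unfolding c_def by (simp only: sum.empty)
      then show ?thesis using True by (simp only: sum.empty zero_ereal_def[symmetric]) simp
    next
      case False
      then have pos: "0 < c y" unfolding c_def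
        by (intro sum_pos finite_subset[OF _ P(1)]) (auto simp: P_def)
      have bound: "f y \<le> ereal (h k)" if "k \<in> P" "v k = y" for k
        using supp that by (auto simp: P_def)
      show ?thesis
      proof (cases "f y")
        case (real r)
        have "c y * r = (\<Sum>k\<in>{k \<in> P. v k = y}. \<mu> k * r)" by (simp add: c_def sum_distrib_right)
        also have "\<dots> \<le> (\<Sum>k\<in>{k \<in> P. v k = y}. \<mu> k * h k)"
          using bound real by (intro sum_mono mult_left_mono) (auto simp: P_def)
        finally show ?thesis using real by simp
      qed (use pos bound False in auto)
    qed
  qed
  also have "\<dots> = ereal (\<Sum>k\<in>P. \<mu> k * h k)" by (simp add: fibre)
  also have "\<dots> = ereal (\<Sum>k\<in>K. \<mu> k * h k)" using restrict[of "\<lambda>k. \<mu> k * h k"] by simp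
  finally show ?thesis .
qed

text \<open>Strict inequality yields an actual competitor without appeal to attainment of the
  minimum. A sum below \<open>\<infinity>\<close> has no infinite term, hence \<open>f\<close> is
  real wherever the weight is positive.\<close>

lemma local_convex_ext_lessE:
  assumes "never_minus_infinity f" "local_convex_ext f x < ereal r"
  obtains c where "\<And>y. y \<in> integral_nbhd x \<Longrightarrow> 0 \<le> c y" "(\<Sum>y\<in>integral_nbhd x. c y) = 1"
    "(\<Sum>y\<in>integral_nbhd x. c y *\<^sub>R real_vec y) = x"
    "\<And>y. y \<in> integral_nbhd x \<Longrightarrow> 0 < c y \<Longrightarrow> f y = ereal (real_of_ereal (f y))"
    "(\<Sum>y\<in>integral_nbhd x. c y * real_of_ereal (f y)) < r"
proof -
  obtain c where c: "(\<Sum>y\<in>integral_nbhd x. c y *\<^sub>R real_vec y) = x" "(\<Sum>y\<in>integral_nbhd x. c y) = 1"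
      "\<And>y. y \<in> integral_nbhd x \<Longrightarrow> 0 \<le> c y"
    and less: "(\<Sum>y\<in>integral_nbhd x. ereal (c y) * f y) < ereal r"
    using assms(2) unfolding local_convex_ext_def Inf_less_iff by blast
  have fin: "f y = ereal (real_of_ereal (f y))" if "y \<in> integral_nbhd x" "0 < c y" for y
  proof -
    have "(\<Sum>y\<in>integral_nbhd x. ereal (c y) * f y) \<noteq> \<infinity>" using less by auto
    then have "ereal (c y) * f y \<noteq> \<infinity>" using that finite_integral_nbhd by (auto simp: sum_Pinfty)
    then have "f y \<noteq> \<infinity>" using that by auto
    moreover have "f y \<noteq> -\<infinity>" using assms(1) by (auto simp: never_minus_infinity_def)
    ultimately show ?thesis by (cases "f y") auto
  qed
  have "(\<Sum>y\<in>integral_nbhd x. ereal (c y) * f y)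
      = (\<Sum>y\<in>integral_nbhd x. ereal (c y * real_of_ereal (f y)))"
  proof (rule sum.cong)
    fix y assume y: "y \<in> integral_nbhd x"
    show "ereal (c y) * f y = ereal (c y * real_of_ereal (f y))"
    proof (cases "c y = 0")
      case False
      then have "f y = ereal (real_of_ereal (f y))" using fin[OF y] c(3)[OF y] by simp
      then obtain r where "f y = ereal r" by metis
      then show ?thesis by simp
    qed (simp add: zero_ereal_def[symmetric])
  qed simp
  with less have "(\<Sum>y\<in>integral_nbhd x. c y * real_of_ereal (f y)) < r" by simp
  from that[OF c(3,2,1) fin this] show ?thesis by simp
qed

lemma integral_nbhd_real_vec: "integral_nbhd (real_vec v) = {v}"
  by (auto simp: integral_nbhd_def real_vec_def vec_eq_iff
      simp flip: of_int_diff of_int_abs)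

lemma epi_hull_if_local_convex_ext_less:
  assumes "never_minus_infinity f" "local_convex_ext f x < ereal r"
  shows "(x, r) \<in> epi_hull f"
proof -
  obtain c where c: "\<And>y. y \<in> integral_nbhd x \<Longrightarrow> 0 \<le> c y" "(\<Sum>y\<in>integral_nbhd x. c y) = 1"
    "(\<Sum>y\<in>integral_nbhd x. c y *\<^sub>R real_vec y) = x"
    "\<And>y. y \<in> integral_nbhd x \<Longrightarrow> 0 < c y \<Longrightarrow> f y = ereal (real_of_ereal (f y))"
    "(\<Sum>y\<in>integral_nbhd x. c y * real_of_ereal (f y)) < r"
    using local_convex_ext_lessE[OF assms] by blast
  define P where "P = {y \<in> integral_nbhd x. 0 < c y}"
  \<comment> \<open>The weights sum to 1, so adding the slack \<open>d\<close> to every height lifts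
    the combination to exactly \<open>r\<close>.\<close>
  define d where "d = r - (\<Sum>y\<in>integral_nbhd x. c y * real_of_ereal (f y))"
  have restrict: "(\<Sum>k\<in>P. g k) = (\<Sum>k\<in>integral_nbhd x. g k)"
    if "\<And>k. c k = 0 \<Longrightarrow> g k = 0" for g :: "_ \<Rightarrow> 'c::comm_monoid_add"
    by (rule sum.mono_neutral_left)
      (use finite_integral_nbhd c(1) that in \<open>auto simp: P_def order.order_iff_strict\<close>)
  have "(\<Sum>y\<in>P. c y *\<^sub>R (real_vec y, real_of_ereal (f y) + d)) \<in> epi_hull f"
    unfolding epi_hull_def
  proof (rule convex_sum)
    show "finite P" unfolding P_def by (rule finite_subset[OF _ finite_integral_nbhd[of x]]) auto
    show "(\<Sum>y\<in>P. c y) = 1" using restrict[of c] c(2) by simp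
    fix y assume y: "y \<in> P"
    have "f y = ereal (real_of_ereal (f y))" using c(4) y by (auto simp: P_def)
    moreover have "ereal (real_of_ereal (f y)) \<le> ereal (real_of_ereal (f y) + d)"
      using c(5) by (simp add: d_def)
    ultimately have "f y \<le> ereal (real_of_ereal (f y) + d)" by metis
    then show "(real_vec y, real_of_ereal (f y) + d) \<in> convex hull {(real_vec v, h) | v h. f v \<le> ereal h}"
      by (intro hull_inc) blast
  qed (auto simp: P_def)
  also have "(\<Sum>y\<in>P. c y *\<^sub>R (real_vec y, real_of_ereal (f y) + d)) = (x, r)"
  proof (rule prod_eqI)
    show "fst (\<Sum>y\<in>P. c y *\<^sub>R (real_vec y, real_of_ereal (f y) + d)) = fst (x, r)"
      using restrict[of "\<lambda>y. c y *\<^sub>R real_vec y"] c(3) by (simp add: fst_sum)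
    have "(\<Sum>y\<in>P. c y * (real_of_ereal (f y) + d))
        = (\<Sum>y\<in>integral_nbhd x. c y * real_of_ereal (f y)) + (\<Sum>y\<in>integral_nbhd x. c y) * d"
      by (subst restrict) (auto simp: distrib_left sum.distrib sum_distrib_right)
    then show "snd (\<Sum>y\<in>P. c y *\<^sub>R (real_vec y, real_of_ereal (f y) + d)) = snd (x, r)"
      using c(2) by (simp add: snd_sum d_def)
  qed
  finally show ?thesis .
qed

text \<open>Forwards, the epigraph of the convex extension is convex and contains the generators of
  \<open>epi_hull f\<close>, hence the whole hull. Backwards, points strictly above the extension
  lie in the convex set \<open>epi_hull f\<close>, so their combinations do too and the assumed
  bound applies to them.\<close>

lemma integrally_convex_iff_epi_hull:
  "integrally_convex f \<longleftrightarrow>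
     never_minus_infinity f \<and> (\<forall>x r. (x, r) \<in> epi_hull f \<longrightarrow> local_convex_ext f x \<le> ereal r)"
proof (intro iffI conjI allI impI)
  assume f: "integrally_convex f"
  then show "never_minus_infinity f" by (simp add: integrally_convex_def)
  fix x r assume xr: "(x, r) \<in> epi_hull f"
  have cvx: "ereal_convex (local_convex_ext f)" using f by (simp add: integrally_convex_def)
  have "epi_hull f \<subseteq> {(x, r). local_convex_ext f x \<le> ereal r}"
    unfolding epi_hull_def
  proof (rule hull_minimal)
    \<comment> \<open>An integer point is its own only neighbor, so the one-point combination is
      admissible.\<close>
    have "local_convex_ext f (real_vec v) \<le> ereal h" if "f v \<le> ereal h" for v h
      using local_convex_ext_le_sum[of "{v}" "\<lambda>_. 1" "\<lambda>v. v" "real_vec v" f "\<lambda>_. h"] that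
      by (simp add: integral_nbhd_real_vec)
    then show "{(real_vec v, h) | v h. f v \<le> ereal h} \<subseteq> {(x, r). local_convex_ext f x \<le> ereal r}"
      by auto
    show "convex {(x, r). local_convex_ext f x \<le> ereal r}"
    proof (clarsimp simp: convex_alt)
      fix x r y s and t :: real
      assume le: "local_convex_ext f x \<le> ereal r" "local_convex_ext f y \<le> ereal s" and t: "0 \<le> t" "t \<le> 1"
      have "local_convex_ext f ((1 - t) *\<^sub>R x + t *\<^sub>R y)
          \<le> ereal (1 - t) * local_convex_ext f x + ereal t * local_convex_ext f y"
        using cvx t unfolding ereal_convex_def by auto
      also have "\<dots> \<le> ereal (1 - t) * ereal r + ereal t * ereal s"
        using le t by (intro add_mono ereal_mult_left_mono) auto
      finally show "local_convex_ext f ((1 - t) *\<^sub>R x + t *\<^sub>R y) \<le> ereal ((1 - t) * r + t * s)" by simp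
    qed
  qed
  with xr show "local_convex_ext f x \<le> ereal r" by auto
next
  assume "never_minus_infinity f \<and> (\<forall>x r. (x, r) \<in> epi_hull f \<longrightarrow> local_convex_ext f x \<le> ereal r)"
  then have nm: "never_minus_infinity f"
    and hull: "\<And>x r. (x, r) \<in> epi_hull f \<Longrightarrow> local_convex_ext f x \<le> ereal r" by auto
  have less: "local_convex_ext f ((1 - t) *\<^sub>R x + t *\<^sub>R y) \<le> ereal ((1 - t) * r + t * s)"
    if "local_convex_ext f x < ereal r" "local_convex_ext f y < ereal s" "0 \<le> t" "t \<le> 1" for x y r s t
  proof (rule hull)
    have "convex (epi_hull f)" by (simp add: epi_hull_def)
    from this[unfolded convex_alt, rule_format, OF epi_hull_if_local_convex_ext_less[OF nm that(1)]
        epi_hull_if_local_convex_ext_less[OF nm that(2)], of t] that(3,4)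
    show "((1 - t) *\<^sub>R x + t *\<^sub>R y, (1 - t) * r + t * s) \<in> epi_hull f" by simp
  qed
  \<comment> \<open>Raising both heights by \<open>e\<close> raises their convex combination by
    \<open>e\<close>, so weak bounds follow from strict ones.\<close>
  have le: "local_convex_ext f ((1 - t) *\<^sub>R x + t *\<^sub>R y) \<le> ereal ((1 - t) * r + t * s)"
    if "local_convex_ext f x \<le> ereal r" "local_convex_ext f y \<le> ereal s" "0 \<le> t" "t \<le> 1" for x y r s t
  proof (rule ereal_le_epsilon2)
    fix e :: real assume e: "0 < e"
    have "local_convex_ext f x < ereal (r + e)" "local_convex_ext f y < ereal (s + e)"
      using that e by (auto intro: le_less_trans)
    from less[OF this that(3,4)]
    show "local_convex_ext f ((1 - t) *\<^sub>R x + t *\<^sub>R y) \<le> ereal ((1 - t) * r + t * s) + ereal e"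
      by (simp add: algebra_simps)
  qed
  have "local_convex_ext f ((1 - t) *\<^sub>R x + t *\<^sub>R y)
      \<le> ereal (1 - t) * local_convex_ext f x + ereal t * local_convex_ext f y"
    if "0 \<le> t" "t \<le> 1" for x y t
  proof (cases "t = 0 \<or> t = 1")
    \<comment> \<open>At the endpoints a zero coefficient can hide an infinite value, so real
      heights above both values need not exist.\<close>
    case True
    then show ?thesis by (auto simp flip: zero_ereal_def one_ereal_def)
  next
    case False
    then have t: "0 < t" "t < 1" using that by auto
    \<comment> \<open>Either height can be chosen to make the combination equal to \<open>M\<close>,
      which serves the case of a value \<open>-\<infinity>\<close>. A value
      \<open>\<infinity>\<close> would contradict the real upper bound.\<close>
    have M: "\<exists>r. (1 - t) * r + t * s = M" "\<exists>s. (1 - t) * r + t * s = M" for r s M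
      using t by (auto intro: exI[of _ "(M - t * s) / (1 - t)"] exI[of _ "(M - (1 - t) * r) / t"])
    show ?thesis
    proof (rule ereal_le_real)
      fix M
      assume "ereal (1 - t) * local_convex_ext f x + ereal t * local_convex_ext f y \<le> ereal M"
      then have "\<exists>r s. local_convex_ext f x \<le> ereal r \<and> local_convex_ext f y \<le> ereal s
          \<and> (1 - t) * r + t * s \<le> M"
        using t M by (cases "local_convex_ext f x"; cases "local_convex_ext f y")
          (auto, (metis order_refl)+)
      then obtain r s where "local_convex_ext f x \<le> ereal r" "local_convex_ext f y \<le> ereal s"
          "(1 - t) * r + t * s \<le> M" by blast
      then show "local_convex_ext f ((1 - t) *\<^sub>R x + t *\<^sub>R y) \<le> ereal M"
        using le[of x r y s t] that by (meson ereal_less_eq(3) order_trans)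
    qed
  qed
  then show "integrally_convex f"
    using nm by (auto simp: integrally_convex_def ereal_convex_def)
qed

section \<open>Univariate discrete convex functions\<close>

lemma discrete_convex_finite_between:
  assumes "discrete_convex \<psi>" "\<psi> a \<noteq> \<infinity>" "\<psi> c \<noteq> \<infinity>" "a \<le> t" "t \<le> c"
  shows "\<psi> t \<noteq> \<infinity>"
proof -
  have "\<psi> a < \<infinity> \<longrightarrow> \<psi> c < \<infinity> \<longrightarrow> a \<le> t \<longrightarrow> t \<le> c \<longrightarrow> \<psi> t < \<infinity>"
    using assms(1) unfolding discrete_convex_def by blast
  with assms(2-) show ?thesis by simp
qed

text \<open>Midpoint convexity makes the increments nondecreasing, so the secant through
  \<open>b\<close> and \<open>b + 1\<close> stays below \<open>\<psi>\<close> when extended in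
  either direction.\<close>

lemma discrete_convex_supporting_line:
  assumes \<psi>: "discrete_convex \<psi>" and b: "\<psi> b = ereal \<alpha>" "\<psi> (b + 1) = ereal \<beta>"
  shows "ereal (\<alpha> + (\<beta> - \<alpha>) * real_of_int (m - b)) \<le> \<psi> m"
proof -
  have nm: "\<psi> t \<noteq> -\<infinity>" for t using \<psi> by (simp add: discrete_convex_def never_minus_infinity_def)
  have mid: "2 * \<psi> t \<le> \<psi> (t - 1) + \<psi> (t + 1)" for t using \<psi> by (simp add: discrete_convex_def)
  note dom = discrete_convex_finite_between[OF \<psi>]
  define p where "p t = real_of_ereal (\<psi> t)" for t
  have p: "\<psi> t = ereal (p t)" if "\<psi> t \<noteq> \<infinity>" for t
    using nm[of t] that by (cases "\<psi> t") (auto simp: p_def)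
  have midp: "2 * p t \<le> p (t - 1) + p (t + 1)" if "\<psi> (t - 1) \<noteq> \<infinity>" "\<psi> (t + 1) \<noteq> \<infinity>" for t
  proof -
    have "\<psi> t \<noteq> \<infinity>" using dom[OF that] by simp
    from mid[of t, unfolded p[OF this] p[OF that(1)] p[OF that(2)]] show ?thesis
      by (simp add: numeral_eq_ereal)
  qed
  have pb: "p b = \<alpha>" "p (b + 1) = \<beta>" using b by (auto simp: p_def)
  \<comment> \<open>The induction carries the increment bound along with the line bound. As the
    effective domain has no gaps, finiteness at the far end makes all values back to
    \<open>b\<close> real.\<close>
  have up: "\<psi> m \<noteq> \<infinity> \<longrightarrow> \<beta> - \<alpha> \<le> p m - p (m - 1) \<and> \<alpha> + (\<beta> - \<alpha>) * real_of_int (m - b) \<le> p m"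
    if "b + 1 \<le> m" for m
    using that
  proof (induction m rule: int_ge_induct)
    case base
    then show ?case using pb by simp
  next
    case (step m)
    show ?case
    proof
      assume fin: "\<psi> (m + 1) \<noteq> \<infinity>"
      have fin': "\<psi> m \<noteq> \<infinity>" "\<psi> (m - 1) \<noteq> \<infinity>" using dom[OF _ fin, of b] b step.hyps by auto
      from midp[OF fin'(2) fin] step.IH fin'(1)
      show "\<beta> - \<alpha> \<le> p (m + 1) - p (m + 1 - 1) \<and> \<alpha> + (\<beta> - \<alpha>) * real_of_int (m + 1 - b) \<le> p (m + 1)"
        by (simp add: algebra_simps)
    qed
  qed
  have down: "\<psi> m \<noteq> \<infinity> \<longrightarrow> p (m + 1) - p m \<le> \<beta> - \<alpha> \<and> \<alpha> + (\<beta> - \<alpha>) * real_of_int (m - b) \<le> p m"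
    if "m \<le> b" for m
    using that
  proof (induction m rule: int_le_induct)
    case base
    then show ?case using pb by simp
  next
    case (step m)
    show ?case
    proof
      assume fin: "\<psi> (m - 1) \<noteq> \<infinity>"
      have fin': "\<psi> m \<noteq> \<infinity>" "\<psi> (m + 1) \<noteq> \<infinity>" using dom[OF fin, of "b + 1"] b step.hyps by auto
      from midp[OF fin fin'(2)] step.IH fin'(1)
      show "p (m - 1 + 1) - p (m - 1) \<le> \<beta> - \<alpha> \<and> \<alpha> + (\<beta> - \<alpha>) * real_of_int (m - 1 - b) \<le> p (m - 1)"
        by (simp add: algebra_simps)
    qed
  qed
  show ?thesis
  proof (cases "\<psi> m = \<infinity>")
    case False
    then show ?thesis using up[of m] down[of m] p[OF False] by (cases "m \<le> b") auto
  qed simp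
qed

text \<open>The secant over the unit interval containing \<open>z\<close> lies below
  \<open>\<psi>\<close>, and averaging it over the \<open>w k\<close> gives its value at
  \<open>z\<close>. For integer \<open>z\<close> the value at \<open>\<lfloor>z\<rfloor> + 1\<close>
  may be infinite, but the coefficient \<open>frac z\<close> is then 0 and removes whatever
  \<open>real_of_ereal\<close> returns.\<close>

lemma discrete_convex_jensen:
  fixes w :: "'k \<Rightarrow> int"
  assumes \<psi>: "discrete_convex \<psi>" and K: "finite K"
    and nonneg: "\<And>k. k \<in> K \<Longrightarrow> 0 \<le> \<mu> k" and one: "(\<Sum>k\<in>K. \<mu> k) = 1"
    and bary: "(\<Sum>k\<in>K. \<mu> k * real_of_int (w k)) = z"
    and fin: "\<And>k. k \<in> K \<Longrightarrow> \<psi> (w k) = ereal (h k)"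
  shows "\<psi> \<lfloor>z\<rfloor> = ereal (real_of_ereal (\<psi> \<lfloor>z\<rfloor>))"
    and "0 < frac z \<Longrightarrow> \<psi> (\<lfloor>z\<rfloor> + 1) = ereal (real_of_ereal (\<psi> (\<lfloor>z\<rfloor> + 1)))"
    and "(1 - frac z) * real_of_ereal (\<psi> \<lfloor>z\<rfloor>) + frac z * real_of_ereal (\<psi> (\<lfloor>z\<rfloor> + 1))
      \<le> (\<Sum>k\<in>K. \<mu> k * h k)"
proof -
  have nm: "\<psi> t \<noteq> -\<infinity>" for t using \<psi> by (simp add: discrete_convex_def never_minus_infinity_def)
  note dom = discrete_convex_finite_between[OF \<psi>]
  have p: "\<psi> t = ereal (real_of_ereal (\<psi> t))" if "\<psi> t \<noteq> \<infinity>" for t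
    using nm[of t] that by (cases "\<psi> t") auto
  define b where "b = \<lfloor>z\<rfloor>"
  have dev: "(\<Sum>k\<in>K. \<mu> k * (real_of_int (w k) - y)) = z - y" for y
    using bary one by (simp add: right_diff_distrib sum_subtractf flip: sum_distrib_right)
  \<comment> \<open>Otherwise all the integers \<open>w k\<close>, and hence their mean
    \<open>z\<close>, would be at least \<open>\<lfloor>z\<rfloor> + 1\<close>.\<close>
  have "\<exists>j\<in>K. w j \<le> b"
  proof (rule ccontr)
    assume "\<not> ?thesis"
    then have "0 \<le> \<mu> k * (real_of_int (w k) - real_of_int (b + 1))" if "k \<in> K" for k
      using that nonneg by (intro mult_nonneg_nonneg) force+
    then have "0 \<le> z - real_of_int (b + 1)" unfolding dev[symmetric] by (rule sum_nonneg)
    then show False unfolding b_def by linarith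
  qed
  then obtain j where j: "j \<in> K" "w j \<le> b" by blast
  have "(\<psi> b \<noteq> \<infinity> \<and> (0 < frac z \<longrightarrow> \<psi> (b + 1) \<noteq> \<infinity>)) \<and>
    (1 - frac z) * real_of_ereal (\<psi> b) + frac z * real_of_ereal (\<psi> (b + 1)) \<le> (\<Sum>k\<in>K. \<mu> k * h k)"
  proof (cases "\<exists>k\<in>K. b < w k")
    case True
    then obtain k where k: "k \<in> K" "b < w k" by blast
    \<comment> \<open>\<open>w j \<le> b < w k\<close> places \<open>b\<close> and
      \<open>b + 1\<close> between two points of the effective domain.\<close>
    have finb: "\<psi> b \<noteq> \<infinity>" "\<psi> (b + 1) \<noteq> \<infinity>"
      using dom[of "w j" "w k" b] dom[of "w j" "w k" "b + 1"] j k fin by auto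
    define \<alpha> \<beta> where "\<alpha> = real_of_ereal (\<psi> b)" and "\<beta> = real_of_ereal (\<psi> (b + 1))"
    have line: "\<alpha> + (\<beta> - \<alpha>) * real_of_int (w k - b) \<le> h k" if "k \<in> K" for k
      using discrete_convex_supporting_line[OF \<psi> p[OF finb(1)] p[OF finb(2)], of "w k"] fin[OF that]
      by (simp add: \<alpha>_def \<beta>_def)
    have "(\<Sum>k\<in>K. \<mu> k * (\<alpha> + (\<beta> - \<alpha>) * real_of_int (w k - b))) \<le> (\<Sum>k\<in>K. \<mu> k * h k)"
      using line nonneg by (intro sum_mono mult_left_mono) auto
    also have "(\<Sum>k\<in>K. \<mu> k * (\<alpha> + (\<beta> - \<alpha>) * real_of_int (w k - b)))
        = (\<Sum>k\<in>K. \<mu> k) * \<alpha> + (\<beta> - \<alpha>) * (\<Sum>k\<in>K. \<mu> k * (real_of_int (w k) - real_of_int b))"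
      by (simp add: sum_distrib_left sum_distrib_right sum.distrib[symmetric] algebra_simps)
    also have "\<dots> = \<alpha> + (\<beta> - \<alpha>) * frac z" by (simp add: dev one frac_def b_def)
    finally show ?thesis using finb by (simp add: \<alpha>_def \<beta>_def algebra_simps)
  next
    case False
    \<comment> \<open>With no \<open>w k\<close> above \<open>b\<close>, nonnegative terms sum to
      \<open>- frac z\<close>. This forces \<open>frac z = 0\<close> and puts all positive weight at
      \<open>b\<close>.\<close>
    have nn: "\<forall>k\<in>K. 0 \<le> \<mu> k * (real_of_int b - real_of_int (w k))"
      using False nonneg by (intro ballI mult_nonneg_nonneg) force+
    have sum: "(\<Sum>k\<in>K. \<mu> k * (real_of_int b - real_of_int (w k))) = - frac z"
      using dev[of "real_of_int b"] by (simp add: frac_def b_def right_diff_distrib sum_subtractf)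
    have fr: "frac z = 0" using sum sum_nonneg[of K "\<lambda>k. \<mu> k * (real_of_int b - real_of_int (w k))"] nn frac_ge_0[of z] by simp
    have conc: "\<mu> k = 0 \<or> w k = b" if "k \<in> K" for k
      using sum[unfolded fr] sum_nonneg_eq_0_iff[OF K, of "\<lambda>k. \<mu> k * (real_of_int b - real_of_int (w k))"]
        nn that by auto
    have "\<exists>k\<in>K. \<mu> k \<noteq> 0" using one by (metis sum.neutral zero_neq_one)
    then have finb: "\<psi> b \<noteq> \<infinity>" using conc fin by fastforce
    have "(\<Sum>k\<in>K. \<mu> k * h k) = (\<Sum>k\<in>K. \<mu> k * real_of_ereal (\<psi> b))"
      using conc fin by (intro sum.cong) force+
    then show ?thesis unfolding fr using finb one by (simp flip: sum_distrib_right)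
  qed
  then show "\<psi> \<lfloor>z\<rfloor> = ereal (real_of_ereal (\<psi> \<lfloor>z\<rfloor>))"
    and "0 < frac z \<Longrightarrow> \<psi> (\<lfloor>z\<rfloor> + 1) = ereal (real_of_ereal (\<psi> (\<lfloor>z\<rfloor> + 1)))"
    and "(1 - frac z) * real_of_ereal (\<psi> \<lfloor>z\<rfloor>) + frac z * real_of_ereal (\<psi> (\<lfloor>z\<rfloor> + 1))
      \<le> (\<Sum>k\<in>K. \<mu> k * h k)"
    using p unfolding b_def by blast+
qed

section \<open>Random bits and the coupling of two roundings\<close>

lemma sum_fun_bool_prod:
  fixes F :: "'n::finite \<Rightarrow> bool \<Rightarrow> real"
  shows "(\<Sum>s\<in>UNIV. \<Prod>i\<in>UNIV. F i (s i)) = (\<Prod>i\<in>UNIV. F i True + F i False)"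
proof -
  have "(\<Prod>i\<in>UNIV. F i True + F i False) = (\<Prod>i\<in>UNIV. \<Sum>b\<in>UNIV. F i b)"
    by (simp add: UNIV_bool add.commute)
  also have "\<dots> = (\<Sum>s\<in>PiE UNIV (\<lambda>_. UNIV). \<Prod>i\<in>UNIV. F i (s i))"
    by (rule prod_sum_PiE) auto
  finally show ?thesis by simp
qed

text \<open>The law of independent bits with success probabilities \<open>r i\<close>. A bit will
  decide whether a coordinate is rounded up.\<close>

definition bernoulli_weight :: "('n::finite \<Rightarrow> real) \<Rightarrow> ('n \<Rightarrow> bool) \<Rightarrow> real" where
  "bernoulli_weight r s = (\<Prod>i\<in>UNIV. if s i then r i else 1 - r i)"

lemma sum_bernoulli_weight: "(\<Sum>s\<in>UNIV. bernoulli_weight r s) = 1"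
  unfolding bernoulli_weight_def
  using sum_fun_bool_prod[of "\<lambda>i b. if b then r i else 1 - r i"] by simp

text \<open>Absorbing \<open>F (s i)\<close> into the factor of index \<open>i\<close> keeps the
  product form, and every other factor sums to 1.\<close>

lemma sum_bernoulli_weight_marginal:
  "(\<Sum>s\<in>UNIV. bernoulli_weight r s * F (s i)) = (1 - r i) * F False + r i * F True"
proof -
  let ?G = "\<lambda>j b. (if b then r j else 1 - r j) * (if j = i then F b else 1)"
  have "(\<Prod>j\<in>UNIV. ?G j (s j)) = bernoulli_weight r s * F (s i)" for s
    unfolding bernoulli_weight_def prod.distrib by simp
  then have "(\<Sum>s\<in>UNIV. bernoulli_weight r s * F (s i)) = (\<Prod>j\<in>UNIV. ?G j True + ?G j False)"
    using sum_fun_bool_prod[of ?G] by simp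
  also have "\<dots> = (\<Prod>j\<in>UNIV. if j = i then (1 - r i) * F False + r i * F True else 1)"
    by (intro prod.cong) auto
  finally show ?thesis by simp
qed

lemma bernoulli_weight_nonneg:
  assumes "\<And>i. 0 \<le> r i \<and> r i \<le> 1"
  shows "0 \<le> bernoulli_weight r s"
  unfolding bernoulli_weight_def
proof (rule prod_nonneg)
  show "0 \<le> (if s i then r i else 1 - r i)" for i using assms[of i] by simp
qed

lemma bernoulli_weight_posD:
  assumes "\<And>i. 0 \<le> r i \<and> r i \<le> 1" "0 < bernoulli_weight r s"
  shows "if s i then 0 < r i else r i < 1"
proof -
  have "(if s i then r i else 1 - r i) \<noteq> 0"
    using assms(2) prod_zero_iff[of UNIV "\<lambda>i. if s i then r i else 1 - r i"]
    unfolding bernoulli_weight_def by fastforce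
  then show ?thesis using assms(1)[of i] by (auto simp: order.strict_iff_order split: if_splits)
qed

text \<open>Here \<open>j\<close> tells whether \<open>u\<^sub>i\<close> is rounded up, which has probability \<open>p\<close>, and \<open>\<alpha> + \<beta> * j\<close> is the
  conditional probability that \<open>w\<^sub>i\<close> is rounded up.  As this is affine in \<open>j\<close>, its mean is
  \<open>\<alpha> + \<beta> * p\<close> whatever the joint distribution of the coordinates of \<open>u\<close>.\<close>

lemma bernoulli_coupling:
  fixes p q :: real
  assumes "0 \<le> p" "p < 1" "0 \<le> q" "q < 1"
  shows "\<exists>\<alpha> \<beta>. \<alpha> + \<beta> * p = q \<and> (\<forall>j\<in>{0, 1}. 0 \<le> \<alpha> + \<beta> * j \<and> \<alpha> + \<beta> * j \<le> 1 \<and>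
    (0 < \<alpha> + \<beta> * j \<longrightarrow> 0 < q) \<and>
    (0 < \<alpha> + \<beta> * j \<longrightarrow> (j = 1 \<longrightarrow> 0 < p) \<longrightarrow> \<bar>p + q - (j + 1)\<bar> < 1) \<and>
    (\<alpha> + \<beta> * j < 1 \<longrightarrow> (j = 1 \<longrightarrow> 0 < p) \<longrightarrow> \<bar>p + q - j\<bar> < 1))"
proof (cases "p + q \<le> 1")
  case True
  \<comment> \<open>\<open>t\<close> is the chance of rounding up given \<open>j = 0\<close>. Given
    \<open>j = 1\<close> the chance is 0, and the overall mean \<open>t * (1 - p)\<close> must equal
    \<open>q\<close>.\<close>
  define t where "t = q / (1 - p)"
  have "t * (1 - p) = q" using assms by (simp add: t_def)
  then have "t - t * p = q" by (simp add: right_diff_distrib)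
  moreover have "0 < t \<Longrightarrow> 0 < p + q" "0 \<le> t" "t \<le> 1" "0 < t \<Longrightarrow> 0 < q" "t < 1 \<Longrightarrow> p + q < 1"
    using assms True by (auto simp: t_def divide_simps split: if_splits)
  ultimately show ?thesis using assms True
    by - (rule exI[of _ t], rule exI[of _ "- t"], auto)
next
  case False
  then have pos: "0 < p" "0 < q" using assms by auto
  \<comment> \<open>Given \<open>j = 0\<close> rounding up is certain; \<open>t\<close> is the
    chance given \<open>j = 1\<close>, determined by \<open>(1 - p) + t * p = q\<close>.\<close>
  define t where "t = (p + q - 1) / p"
  have "t * p = p + q - 1" "0 \<le> t" "t \<le> 1"
    using assms False pos by (auto simp: t_def divide_simps)
  then show ?thesis using assms False pos
    by - (rule exI[of _ 1], rule exI[of _ "t - 1"], auto simp: algebra_simps)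
qed

section \<open>Epigraph hulls of convolutions and of separable functions\<close>

text \<open>The infimum in the convolution may fail to be attained, whence the slack
  \<open>e\<close>. Each generator of the hull splits once its height is raised by \<open>e\<close>,
  and the set \<open>T\<close> of points that split in this way is convex.\<close>

lemma epi_hull_convolutionE:
  assumes f: "never_minus_infinity f" and g: "never_minus_infinity g"
    and x: "(x, r) \<in> epi_hull (convolution f g)" and e: "0 < e"
  obtains y s z t where "(y, s) \<in> epi_hull f" "(z, t) \<in> epi_hull g" "x = y + z" "r + e = s + t"
proof -
  define T where "T = {(x, r). \<exists>y s z t. (y, s) \<in> epi_hull f \<and> (z, t) \<in> epi_hull g \<and>
    x = y + z \<and> r + e = s + t}"
  have "epi_hull (convolution f g) \<subseteq> T"
    unfolding epi_hull_def[of "convolution f g"]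
  proof (rule hull_minimal)
    show "{(real_vec v, h) | v h. convolution f g v \<le> ereal h} \<subseteq> T"
    proof clarify
      fix v h
      assume "convolution f g v \<le> ereal h"
      then have "convolution f g v < ereal (h + e)" using e by (auto intro: le_less_trans)
      then obtain u w where v: "v = u + w" and less: "f u + g w < ereal (h + e)"
        unfolding convolution_def Inf_less_iff by blast
      have "f u \<noteq> -\<infinity>" "g w \<noteq> -\<infinity>" using f g by (auto simp: never_minus_infinity_def)
      with less obtain a b where ab: "f u = ereal a" "g w = ereal b"
        by (cases "f u"; cases "g w") auto
      \<comment> \<open>All the height left over from \<open>a\<close> goes to \<open>g\<close>, so
        the two heights add up to exactly \<open>h + e\<close>.\<close>
      have "(real_vec u, a) \<in> epi_hull f" "(real_vec w, h + e - a) \<in> epi_hull g"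
        using ab less unfolding epi_hull_def by (force intro!: hull_inc)+
      then show "(real_vec v, h) \<in> T" unfolding T_def v real_vec_add by force
    qed
    have cvx: "convex (epi_hull f)" "convex (epi_hull g)" by (simp_all add: epi_hull_def)
    show "convex T"
    proof (rule convexI)
      fix p p' and a b :: real
      assume "p \<in> T" "p' \<in> T" and ab: "0 \<le> a" "0 \<le> b" "a + b = 1"
      then obtain x r y s z t x' r' y' s' z' t' where
        1: "p = (x, r)" "(y, s) \<in> epi_hull f" "(z, t) \<in> epi_hull g" "x = y + z" "r + e = s + t" and
        2: "p' = (x', r')" "(y', s') \<in> epi_hull f" "(z', t') \<in> epi_hull g" "x' = y' + z'" "r' + e = s' + t'"
        unfolding T_def by blast
      have "(a *\<^sub>R y + b *\<^sub>R y', a * s + b * s') \<in> epi_hull f"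
        using convexD[OF cvx(1) 1(2) 2(2) ab] by simp
      moreover have "(a *\<^sub>R z + b *\<^sub>R z', a * t + b * t') \<in> epi_hull g"
        using convexD[OF cvx(2) 1(3) 2(3) ab] by simp
      moreover have "a *\<^sub>R x + b *\<^sub>R x' = (a *\<^sub>R y + b *\<^sub>R y') + (a *\<^sub>R z + b *\<^sub>R z')"
        by (simp add: 1 2 algebra_simps)
      moreover have "a * r + b * r' + e = (a * s + b * s') + (a * t + b * t')"
      proof -
        have "e = a * e + b * e" using ab(3) by (simp flip: distrib_right)
        then have "a * r + b * r' + e = a * (r + e) + b * (r' + e)" by (simp add: algebra_simps)
        then show ?thesis unfolding 1(5) 2(5) by (simp add: algebra_simps)
      qed
      ultimately show "a *\<^sub>R p + b *\<^sub>R p' \<in> T" unfolding T_def 1(1) 2(1) by simp blast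
    qed
  qed
  with x have "(x, r) \<in> T" by blast
  then show ?thesis unfolding T_def using that by blast
qed

text \<open>The weights of a convex combination of epigraph points serve all coordinates at once, so
  the univariate Jensen bound applies to each \<open>z $ i\<close> and the bounds add up.\<close>

lemma epi_hull_separable:
  fixes \<psi> :: "'n::finite \<Rightarrow> int \<Rightarrow> ereal"
  assumes \<psi>: "\<And>i. discrete_convex (\<psi> i)" and \<phi>: "\<And>x. \<phi> x = (\<Sum>i\<in>UNIV. \<psi> i (x $ i))"
    and z: "(z, r) \<in> epi_hull \<phi>"
  shows "\<psi> i \<lfloor>z $ i\<rfloor> = ereal (real_of_ereal (\<psi> i \<lfloor>z $ i\<rfloor>))"
    and "0 < frac (z $ i) \<Longrightarrow> \<psi> i (\<lfloor>z $ i\<rfloor> + 1) = ereal (real_of_ereal (\<psi> i (\<lfloor>z $ i\<rfloor> + 1)))"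
    and "(\<Sum>i\<in>UNIV. (1 - frac (z $ i)) * real_of_ereal (\<psi> i \<lfloor>z $ i\<rfloor>)
      + frac (z $ i) * real_of_ereal (\<psi> i (\<lfloor>z $ i\<rfloor> + 1))) \<le> r"
proof -
  obtain k \<mu> P where P: "\<And>j. j \<in> {1..k::nat} \<Longrightarrow> 0 \<le> \<mu> j"
      "\<And>j. j \<in> {1..k} \<Longrightarrow> P j \<in> {(real_vec v, h) | v h. \<phi> v \<le> ereal h}"
    and one: "sum \<mu> {1..k} = 1" and sum: "(\<Sum>j\<in>{1..k}. \<mu> j *\<^sub>R P j) = (z, r)"
    using z unfolding epi_hull_def convex_hull_indexed by blast
  have "\<exists>w h. \<forall>j\<in>{1..k}. P j = (real_vec (w j), h j) \<and> \<phi> (w j) \<le> ereal (h j)"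
    using P(2) by (simp only: mem_Collect_eq) metis
  then obtain w h where w: "\<And>j. j \<in> {1..k} \<Longrightarrow> P j = (real_vec (w j), h j)"
      "\<And>j. j \<in> {1..k} \<Longrightarrow> \<phi> (w j) \<le> ereal (h j)" by blast
  have zw: "(\<Sum>j\<in>{1..k}. \<mu> j *\<^sub>R real_vec (w j)) = z" "(\<Sum>j\<in>{1..k}. \<mu> j * h j) = r"
    using arg_cong[OF sum, of fst] arg_cong[OF sum, of snd] w(1)
    by (simp_all add: fst_sum snd_sum)
  have zi: "(\<Sum>j\<in>{1..k}. \<mu> j * real_of_int (w j $ i)) = z $ i" for i
    using arg_cong[OF zw(1), of "\<lambda>v. v $ i"] by (simp add: real_vec_def)
  have fin: "\<psi> i (w j $ i) = ereal (real_of_ereal (\<psi> i (w j $ i)))" if "j \<in> {1..k}" for i j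
  proof -
    have "\<phi> (w j) \<noteq> \<infinity>" using w(2)[OF that] by auto
    then have "\<psi> i (w j $ i) \<noteq> \<infinity>" by (auto simp: \<phi> sum_Pinfty)
    moreover have "\<psi> i (w j $ i) \<noteq> -\<infinity>"
      using \<psi>[of i] by (simp add: discrete_convex_def never_minus_infinity_def)
    ultimately show ?thesis by (cases "\<psi> i (w j $ i)") auto
  qed
  note jensen = discrete_convex_jensen[OF \<psi> finite_atLeastAtMost P(1) one zi fin]
  show "\<psi> i \<lfloor>z $ i\<rfloor> = ereal (real_of_ereal (\<psi> i \<lfloor>z $ i\<rfloor>))"
    and "0 < frac (z $ i) \<Longrightarrow> \<psi> i (\<lfloor>z $ i\<rfloor> + 1) = ereal (real_of_ereal (\<psi> i (\<lfloor>z $ i\<rfloor> + 1)))"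
    using jensen(1,2)[of i] by simp_all
  have "(\<Sum>i\<in>UNIV. (1 - frac (z $ i)) * real_of_ereal (\<psi> i \<lfloor>z $ i\<rfloor>)
      + frac (z $ i) * real_of_ereal (\<psi> i (\<lfloor>z $ i\<rfloor> + 1)))
    \<le> (\<Sum>i\<in>UNIV. \<Sum>j\<in>{1..k}. \<mu> j * real_of_ereal (\<psi> i (w j $ i)))"
    using jensen(3) by (intro sum_mono) simp
  also have "\<dots> = (\<Sum>j\<in>{1..k}. \<mu> j * (\<Sum>i\<in>UNIV. real_of_ereal (\<psi> i (w j $ i))))"
    by (subst sum.swap) (simp add: sum_distrib_left)
  also have "\<dots> \<le> (\<Sum>j\<in>{1..k}. \<mu> j * h j)"
  proof (intro sum_mono mult_left_mono)
    fix j assume j: "j \<in> {1..k}"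
    have "\<phi> (w j) = ereal (\<Sum>i\<in>UNIV. real_of_ereal (\<psi> i (w j $ i)))"
      unfolding \<phi> sum_ereal[symmetric] using fin[OF j] by (intro sum.cong refl)
    with w(2)[OF j] show "(\<Sum>i\<in>UNIV. real_of_ereal (\<psi> i (w j $ i))) \<le> h j" by simp
  qed (use P(1) in auto)
  finally show "(\<Sum>i\<in>UNIV. (1 - frac (z $ i)) * real_of_ereal (\<psi> i \<lfloor>z $ i\<rfloor>)
      + frac (z $ i) * real_of_ereal (\<psi> i (\<lfloor>z $ i\<rfloor> + 1))) \<le> r" using zw(2) by simp
qed

section \<open>The convolution at a sum of two points\<close>

text \<open>Pairs \<open>(u, d)\<close> index the joint law: \<open>u\<close> has weight
  \<open>c u\<close>, and given \<open>u\<close> the bits \<open>d\<close> are independent with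
  probabilities depending on \<open>u\<close>. The points \<open>u + w d\<close> are then fed to
  \<open>local_convex_ext_le_sum\<close>.\<close>

lemma local_convex_ext_convolution_le:
  fixes \<psi> :: "'n::finite \<Rightarrow> int \<Rightarrow> ereal"
  assumes f: "never_minus_infinity f" and \<phi>: "\<And>x. \<phi> x = (\<Sum>i\<in>UNIV. \<psi> i (x $ i))"
    and y: "local_convex_ext f y < ereal s"
    and fin0: "\<And>i. \<psi> i \<lfloor>z $ i\<rfloor> = ereal (real_of_ereal (\<psi> i \<lfloor>z $ i\<rfloor>))"
    and fin1: "\<And>i. 0 < frac (z $ i) \<Longrightarrow>
      \<psi> i (\<lfloor>z $ i\<rfloor> + 1) = ereal (real_of_ereal (\<psi> i (\<lfloor>z $ i\<rfloor> + 1)))"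
  shows "local_convex_ext (convolution f \<phi>) (y + z) \<le> ereal (s + (\<Sum>i\<in>UNIV.
    (1 - frac (z $ i)) * real_of_ereal (\<psi> i \<lfloor>z $ i\<rfloor>)
      + frac (z $ i) * real_of_ereal (\<psi> i (\<lfloor>z $ i\<rfloor> + 1))))"
proof -
  obtain c where c: "\<And>u. u \<in> integral_nbhd y \<Longrightarrow> 0 \<le> c u" "(\<Sum>u\<in>integral_nbhd y. c u) = 1"
    "(\<Sum>u\<in>integral_nbhd y. c u *\<^sub>R real_vec u) = y"
    "\<And>u. u \<in> integral_nbhd y \<Longrightarrow> 0 < c u \<Longrightarrow> f u = ereal (real_of_ereal (f u))"
    "(\<Sum>u\<in>integral_nbhd y. c u * real_of_ereal (f u)) < s"
    using local_convex_ext_lessE[OF f y] by blast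
  define a where "a i = \<lfloor>y $ i\<rfloor>" for i
  define b where "b i = \<lfloor>z $ i\<rfloor>" for i
  define p where "p i = frac (y $ i)" for i
  define q where "q i = frac (z $ i)" for i
  \<comment> \<open>If \<open>q i = 0\<close>, then \<open>E i True\<close> may be the default 0 of
    \<open>real_of_ereal\<close> at \<open>\<infinity>\<close>; it always enters with probability 0
    in that case.\<close>
  define E where "E i d = real_of_ereal (\<psi> i (b i + (if d then 1 else 0)))" for i d
  have y_eq: "y $ i = a i + p i" and z_eq: "z $ i = b i + q i" for i
    by (simp_all add: a_def b_def p_def q_def frac_def)
  have pq: "0 \<le> p i" "p i < 1" "0 \<le> q i" "q i < 1" for i
    by (simp_all add: p_def q_def frac_lt_1)
  have "\<forall>i. \<exists>\<alpha> \<beta>. \<alpha> + \<beta> * p i = q i \<and> (\<forall>j\<in>{0, 1}. 0 \<le> \<alpha> + \<beta> * j \<and> \<alpha> + \<beta> * j \<le> 1 \<and>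
    (0 < \<alpha> + \<beta> * j \<longrightarrow> 0 < q i) \<and>
    (0 < \<alpha> + \<beta> * j \<longrightarrow> (j = 1 \<longrightarrow> 0 < p i) \<longrightarrow> \<bar>p i + q i - (j + 1)\<bar> < 1) \<and>
    (\<alpha> + \<beta> * j < 1 \<longrightarrow> (j = 1 \<longrightarrow> 0 < p i) \<longrightarrow> \<bar>p i + q i - j\<bar> < 1))"
    using bernoulli_coupling pq by blast
  from this[unfolded choice_iff] obtain \<alpha> \<beta> where mean: "\<And>i. \<alpha> i + \<beta> i * p i = q i" and
    coupling: "\<And>i j. j \<in> {0, 1} \<Longrightarrow> 0 \<le> \<alpha> i + \<beta> i * j \<and> \<alpha> i + \<beta> i * j \<le> 1 \<and>
    (0 < \<alpha> i + \<beta> i * j \<longrightarrow> 0 < q i) \<and>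
    (0 < \<alpha> i + \<beta> i * j \<longrightarrow> (j = 1 \<longrightarrow> 0 < p i) \<longrightarrow> \<bar>p i + q i - (j + 1)\<bar> < 1) \<and>
    (\<alpha> i + \<beta> i * j < 1 \<longrightarrow> (j = 1 \<longrightarrow> 0 < p i) \<longrightarrow> \<bar>p i + q i - j\<bar> < 1)" by blast
  \<comment> \<open>\<open>r u i\<close> is the conditional probability, given \<open>u\<close>,
    that \<open>z $ i\<close> is rounded up.\<close>
  define r where "r u i = \<alpha> i + \<beta> i * real_of_int (u $ i - a i)" for u :: "int ^ 'n" and i
  define w :: "('n \<Rightarrow> bool) \<Rightarrow> int ^ 'n" where "w d = (\<chi> i. b i + (if d i then 1 else 0))" for d
  \<comment> \<open>A neighbor of \<open>y\<close> rounds each coordinate down or up, and up only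
    where \<open>y $ i\<close> is not an integer.\<close>
  have bit: "real_of_int (u $ i - a i) \<in> {0, 1}" "real_of_int (u $ i - a i) = 1 \<longrightarrow> 0 < p i"
    if "u \<in> integral_nbhd y" for u i
  proof -
    have "\<bar>a i + p i - real_of_int (u $ i)\<bar> < 1" using that by (auto simp: integral_nbhd_def y_eq)
    then have "-1 < u $ i - a i" "u $ i - a i < 2" "u $ i - a i = 1 \<longrightarrow> 0 < p i"
      using pq[of i] by linarith+
    then have "u $ i - a i = 0 \<or> u $ i - a i = 1" "u $ i - a i = 1 \<longrightarrow> 0 < p i" by linarith+
    then show "real_of_int (u $ i - a i) \<in> {0, 1}" "real_of_int (u $ i - a i) = 1 \<longrightarrow> 0 < p i"
      by (metis insertCI of_int_0 of_int_1, metis of_int_eq_1_iff)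
  qed
  have coupling: "0 \<le> r u i \<and> r u i \<le> 1 \<and> (0 < r u i \<longrightarrow> 0 < q i) \<and>
    (0 < r u i \<longrightarrow> \<bar>p i + q i - (real_of_int (u $ i - a i) + 1)\<bar> < 1) \<and>
    (r u i < 1 \<longrightarrow> \<bar>p i + q i - real_of_int (u $ i - a i)\<bar> < 1)"
    if "u \<in> integral_nbhd y" for u i
    using coupling[OF bit(1)[OF that, of i], of i] bit(2)[OF that, of i] unfolding r_def by blast
  let ?B = "\<lambda>u. bernoulli_weight (r u)"
  let ?K = "integral_nbhd y \<times> (UNIV :: ('n \<Rightarrow> bool) set)"
  have B01: "\<And>i. 0 \<le> r u i \<and> r u i \<le> 1" if "u \<in> integral_nbhd y" for u
    using coupling[OF that] by blast
  have mean_r: "(\<Sum>u\<in>integral_nbhd y. c u * r u i) = q i" for i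
  proof -
    have "(\<Sum>u\<in>integral_nbhd y. c u * real_of_int (u $ i)) = y $ i"
      using arg_cong[OF c(3), of "\<lambda>v. v $ i"] by (simp add: real_vec_def)
    then have "(\<Sum>u\<in>integral_nbhd y. c u * real_of_int (u $ i - a i)) = p i"
      using c(2) by (simp add: y_eq right_diff_distrib sum_subtractf flip: sum_distrib_right)
    moreover have "(\<Sum>u\<in>integral_nbhd y. c u * r u i)
        = (\<Sum>u\<in>integral_nbhd y. c u) * \<alpha> i + \<beta> i * (\<Sum>u\<in>integral_nbhd y. c u * real_of_int (u $ i - a i))"
      unfolding r_def sum_distrib_left sum_distrib_right sum.distrib[symmetric]
      by (intro sum.cong refl) (simp add: algebra_simps)
    ultimately show ?thesis using c(2) mean by simp
  qed
  \<comment> \<open>This one identity gives the mean of \<open>u + w d\<close> in each coordinate,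
    the contribution of \<open>f\<close> and that of \<open>\<phi>\<close>.\<close>
  have expect: "(\<Sum>(u, d)\<in>?K. c u * ?B u d * (A u + F (d i)))
      = (\<Sum>u\<in>integral_nbhd y. c u * A u) + (1 - q i) * F False + q i * F True"
    for A F i
  proof -
    have "(\<Sum>(u, d)\<in>?K. c u * ?B u d * (A u + F (d i)))
        = (\<Sum>u\<in>integral_nbhd y. c u * (\<Sum>d\<in>UNIV. ?B u d * (A u + F (d i))))"
      by (simp add: sum.cartesian_product[symmetric] sum_distrib_left mult.assoc)
    also have "\<dots> = (\<Sum>u\<in>integral_nbhd y. c u * A u + c u * F False + c u * r u i * (F True - F False))"
    proof (intro sum.cong refl)
      fix u
      have "(\<Sum>d\<in>UNIV. ?B u d * (A u + F (d i)))
          = (\<Sum>d\<in>UNIV. ?B u d) * A u + (\<Sum>d\<in>UNIV. ?B u d * F (d i))"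
        by (simp add: distrib_left sum.distrib sum_distrib_right)
      then show "c u * (\<Sum>d\<in>UNIV. ?B u d * (A u + F (d i)))
          = c u * A u + c u * F False + c u * r u i * (F True - F False)"
        by (simp add: sum_bernoulli_weight sum_bernoulli_weight_marginal) (simp add: algebra_simps)
    qed
    also have "\<dots> = (\<Sum>u\<in>integral_nbhd y. c u * A u) + F False + q i * (F True - F False)"
      by (simp add: sum.distrib c(2) mean_r flip: sum_distrib_right)
    finally show ?thesis by (simp add: algebra_simps)
  qed
  have "local_convex_ext (convolution f \<phi>) (y + z) \<le> ereal (\<Sum>k\<in>?K.
      (case k of (u, d) \<Rightarrow> c u * ?B u d) *
      (case k of (u, d) \<Rightarrow> real_of_ereal (f u) + (\<Sum>i\<in>UNIV. E i (d i))))"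
  proof (rule local_convex_ext_le_sum[where v = "\<lambda>(u, d). u + w d"])
    show "finite ?K" by (intro finite_cartesian_product finite_integral_nbhd) simp
    show "0 \<le> (case k of (u, d) \<Rightarrow> c u * ?B u d)" if "k \<in> ?K" for k
      using that c(1) B01 by (auto intro!: mult_nonneg_nonneg bernoulli_weight_nonneg)
    show "(\<Sum>k\<in>?K. case k of (u, d) \<Rightarrow> c u * ?B u d) = 1"
      using c(2) by (simp add: sum.cartesian_product[symmetric] sum_bernoulli_weight
          flip: sum_distrib_left)
    show "(\<Sum>k\<in>?K. (case k of (u, d) \<Rightarrow> c u * ?B u d) *\<^sub>R real_vec (case k of (u, d) \<Rightarrow> u + w d)) = y + z"
    proof (rule vec_eq_iff[THEN iffD2], rule allI)
      fix i
      have "(\<Sum>k\<in>?K. (case k of (u, d) \<Rightarrow> c u * ?B u d) *\<^sub>R real_vec (case k of (u, d) \<Rightarrow> u + w d)) $ i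
        = (\<Sum>(u, d)\<in>?K. c u * ?B u d *
            (real_of_int (u $ i) + real_of_int (b i + (if d i then 1 else 0))))"
        unfolding sum_component
        by (intro sum.cong refl) (auto simp: real_vec_def w_def)
      also have "\<dots> = (\<Sum>u\<in>integral_nbhd y. c u * real_of_int (u $ i)) + b i + q i"
        using expect[of "\<lambda>u. real_of_int (u $ i)" "\<lambda>d. real_of_int (b i + (if d then 1 else 0))" i]
        by (simp add: algebra_simps)
      also have "(\<Sum>u\<in>integral_nbhd y. c u * real_of_int (u $ i)) = y $ i"
        using arg_cong[OF c(3), of "\<lambda>v. v $ i"] by (simp add: real_vec_def)
      finally show "(\<Sum>k\<in>?K. (case k of (u, d) \<Rightarrow> c u * ?B u d) *\<^sub>R
          real_vec (case k of (u, d) \<Rightarrow> u + w d)) $ i = (y + z) $ i"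
        by (simp add: z_eq)
    qed
  next
    fix k assume k: "k \<in> ?K" "0 < (case k of (u, d) \<Rightarrow> c u * ?B u d)"
    obtain u d where ud: "k = (u, d)" by force
    have u: "u \<in> integral_nbhd y" using k ud by simp
    have pos: "0 < c u" "0 < ?B u d"
      using k ud c(1)[OF u] bernoulli_weight_nonneg[of "r u" d, OF B01[OF u]]
      by (auto simp: zero_less_mult_iff)
    note pos_i = bernoulli_weight_posD[of "r u" d, OF B01[OF u] pos(2)]
    have "u + w d \<in> integral_nbhd (y + z)"
      unfolding integral_nbhd_def
    proof clarsimp
      fix i
      \<comment> \<open>The floors \<open>a i\<close> and \<open>b i\<close> cancel, leaving the
        fractional parts and the two rounding bits, which the coupling controls.\<close>
      define j where "j = real_of_int (u $ i - a i)"
      have "\<bar>p i + q i - (j + (if d i then 1 else 0))\<bar> < 1"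
        using coupling[OF u, of i] pos_i[of i] by (auto simp: j_def split: if_splits)
      then show "\<bar>y $ i + z $ i - (real_of_int (u $ i) + real_of_int (w d $ i))\<bar> < 1"
        unfolding y_eq z_eq j_def w_def by (simp add: algebra_simps split: if_splits)
    qed
    moreover have "convolution f \<phi> (u + w d) \<le> ereal (real_of_ereal (f u) + (\<Sum>i\<in>UNIV. E i (d i)))"
    proof -
      have "\<psi> i (w d $ i) = ereal (E i (d i))" for i
      proof (cases "d i")
        case True
        \<comment> \<open>A bit that is \<open>True\<close> with positive weight has
          \<open>0 < r u i\<close>, and the coupling turns this into \<open>0 < q i\<close>.\<close>
        then have "0 < frac (z $ i)" using pos_i[of i] coupling[OF u, of i] by (simp add: q_def)
        from fin1[OF this] show ?thesis using True unfolding E_def w_def b_def by (simp only: vec_lambda_beta if_True)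
      next
        case False
        from fin0[of i] show ?thesis
          using False unfolding E_def w_def b_def by (simp only: vec_lambda_beta if_False add_0_right)
      qed
      then have "\<phi> (w d) = ereal (\<Sum>i\<in>UNIV. E i (d i))" by (simp add: \<phi>)
      moreover have "convolution f \<phi> (u + w d) \<le> f u + \<phi> (w d)"
        unfolding convolution_def by (intro Inf_lower) blast
      ultimately show ?thesis using c(4)[OF u pos(1)] by (metis plus_ereal.simps(1))
    qed
    ultimately show "(case k of (u, d) \<Rightarrow> u + w d) \<in> integral_nbhd (y + z) \<and>
        convolution f \<phi> (case k of (u, d) \<Rightarrow> u + w d)
        \<le> ereal (case k of (u, d) \<Rightarrow> real_of_ereal (f u) + (\<Sum>i\<in>UNIV. E i (d i)))"
      by (simp add: ud)
  qed
  also have "(\<Sum>k\<in>?K. (case k of (u, d) \<Rightarrow> c u * ?B u d) *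
      (case k of (u, d) \<Rightarrow> real_of_ereal (f u) + (\<Sum>i\<in>UNIV. E i (d i))))
    = (\<Sum>(u, d)\<in>?K. c u * ?B u d * real_of_ereal (f u))
      + (\<Sum>i\<in>UNIV. \<Sum>(u, d)\<in>?K. c u * ?B u d * E i (d i))"
    by (subst sum.swap) (simp add: case_prod_unfold distrib_left sum.distrib sum_distrib_left)
  also have "(\<Sum>(u, d)\<in>?K. c u * ?B u d * real_of_ereal (f u))
      = (\<Sum>u\<in>integral_nbhd y. c u * real_of_ereal (f u))"
    using expect[of "\<lambda>u. real_of_ereal (f u)" "\<lambda>_. 0"] by simp
  also have "(\<Sum>i\<in>UNIV. \<Sum>(u, d)\<in>?K. c u * ?B u d * E i (d i))
      = (\<Sum>i\<in>UNIV. (1 - q i) * E i False + q i * E i True)"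
    using expect[of "\<lambda>_. 0"] by simp
  also have "ereal ((\<Sum>u\<in>integral_nbhd y. c u * real_of_ereal (f u))
        + (\<Sum>i\<in>UNIV. (1 - q i) * E i False + q i * E i True))
      \<le> ereal (s + (\<Sum>i\<in>UNIV. (1 - q i) * E i False + q i * E i True))"
    using c(5) by simp
  finally show ?thesis unfolding E_def q_def b_def if_True if_False add_0_right .
qed

theorem theorem4p2:
  fixes f \<phi> :: "int ^ 'n \<Rightarrow> ereal"
  assumes "integrally_convex f"
    and "separable_convex \<phi>"
    and "\<forall>x. convolution f \<phi> x \<noteq> -\<infinity>"
  shows "integrally_convex (convolution f \<phi>)"
proof -
  obtain \<psi> :: "'n \<Rightarrow> int \<Rightarrow> ereal" where \<psi>: "\<And>i. discrete_convex (\<psi> i)"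
    and \<phi>: "\<And>x. \<phi> x = (\<Sum>i\<in>UNIV. \<psi> i (x $ i))"
    using assms(2) unfolding separable_convex_def by blast
  have f: "never_minus_infinity f"
    and f_hull: "\<And>y s. (y, s) \<in> epi_hull f \<Longrightarrow> local_convex_ext f y \<le> ereal s"
    using assms(1) unfolding integrally_convex_iff_epi_hull by blast+
  have "(\<Sum>i\<in>A. \<psi> i (x $ i)) \<noteq> -\<infinity>" for x A
  proof -
    have "\<psi> i t \<noteq> -\<infinity>" for i t
      using \<psi>[of i] unfolding discrete_convex_def never_minus_infinity_def by blast
    then show ?thesis by (induction A rule: infinite_finite_induct) auto
  qed
  then have \<phi>_nm: "never_minus_infinity \<phi>"
    by (simp only: never_minus_infinity_def \<phi> not_False_eq_True simp_thms)
  have "local_convex_ext (convolution f \<phi>) x \<le> ereal r"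
    if x: "(x, r) \<in> epi_hull (convolution f \<phi>)" for x r
  proof (rule ereal_le_epsilon2)
    fix e :: real assume "0 < e"
    \<comment> \<open>Half of \<open>e\<close> pays for splitting the hull point, the other half for
      the strict bound at \<open>y\<close>.\<close>
    then have e: "0 < e / 2" by simp
    obtain y s z t where y: "(y, s) \<in> epi_hull f" and z: "(z, t) \<in> epi_hull \<phi>"
      and sum: "x = y + z" "r + e / 2 = s + t"
      using epi_hull_convolutionE[OF f \<phi>_nm x e] by blast
    note \<phi>z = epi_hull_separable[OF \<psi> \<phi> z]
    have "local_convex_ext f y < ereal (s + e / 2)"
      using f_hull[OF y] e by (auto intro: le_less_trans)
    note local_convex_ext_convolution_le[OF f \<phi> this \<phi>z(1,2), folded sum(1)]
    also have "ereal (s + e / 2 + (\<Sum>i\<in>UNIV. (1 - frac (z $ i)) * real_of_ereal (\<psi> i \<lfloor>z $ i\<rfloor>)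
      + frac (z $ i) * real_of_ereal (\<psi> i (\<lfloor>z $ i\<rfloor> + 1)))) \<le> ereal r + ereal e"
      using \<phi>z(3) sum(2) by simp
    finally show "local_convex_ext (convolution f \<phi>) x \<le> ereal r + ereal e" .
  qed
  moreover have "never_minus_infinity (convolution f \<phi>)"
    using assms(3) by (simp add: never_minus_infinity_def)
  ultimately show ?thesis unfolding integrally_convex_iff_epi_hull by blast
qed

end
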